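(* Any surface in $\mathbb{R}^3$ whose invariants $K,H,H'$ satisfy a linear relation $$\delta K=\alpha H+\beta H'+\gamma,\qquad \alpha,\beta,\gamma,\delta \text{ constants},\quad \alpha^2-\beta^2+4\gamma\delta\neq0,$$ is a linear fractional Weingarten surface, i.e. a Weingarten surface whose principal curvatures are related by $$\nu_1=\frac{A\nu_2+B}{C\nu_2+D},\qquad A,B,C,D \text{ constants},\quad BC-AD\neq0;$$ and vice versa, the invariants $K,H,H'$ of any linear fractional Weingarten surface satisfy a linear relation of the form $$\delta K=\alpha H+\beta H'+\gamma,\qquad \alpha,\beta,\gamma,\delta \text{ constants},\quad \alpha^2-\beta^2+4\gamma\delta\neq0.$$
   Context: Surfaces are sufficiently smooth, $S: z=z(u,v)$, $(u,v)\in\mathcal{D}$ ($\mathcal D\subset\mathbb{R}^2$ open and connected), in Euclidean $\mathbb{R}^3$, without umbilical points, parameterized by principal parameters (the coefficients of the first and second fundamental forms satisfy $F=M=0$). Principal curvatures: $\nu_1=L/E$, $\nu_2=N/G$, with $\nu_1-\nu_2>0$. $K=\nu_1\nu_2$ is the Gauss curvature, $H=\frac{\nu_1+\nu_2}{2}$ the mean curvature and $H'=\frac{\nu_1-\nu_2}{2}=\sqrt{H^2-K}$. With the principal geodesic curvatures $\gamma_1=-\frac{E_v}{2E\sqrt G}$, $\gamma_2=\frac{G_u}{2G\sqrt E}$, the surfaces considered satisfy either $\gamma_1\gamma_2\neq0$ everywhere on $\mathcal D$, or $\gamma_1=0$ and $\gamma_2\neq0$ everywhere on $\mathcal D$. By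 the Codazzi equations $\gamma_1=\frac{(\nu_1)_v}{\sqrt G(\nu_1-\nu_2)}$, $\gamma_2=\frac{(\nu_2)_u}{\sqrt E(\nu_1-\nu_2)}$. Weingarten surface: there are differentiable functions $f,g$ on an interval with $f-g\neq0$, $f'g'\neq0$ and a function $\nu(u,v)$ with $(\nu_u,\nu_v)\neq(0,0)$ on $\mathcal D$ such that $\nu_1=f(\nu)$, $\nu_2=g(\nu)$. *)

theory Defs
  imports "HOL-Analysis.Analysis"
begin

text \<open>Partial derivatives with respect to the first and second coordinate of the parameter plane.\<close>

definition d_u :: "(real \<times> real \<Rightarrow> 'a::real_normed_vector) \<Rightarrow> real \<times> real \<Rightarrow> 'a" where
  "d_u h p = vector_derivative (\<lambda>t. h (t, snd p)) (at (fst p))"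

definition d_v :: "(real \<times> real \<Rightarrow> 'a::real_normed_vector) \<Rightarrow> real \<times> real \<Rightarrow> 'a" where
  "d_v h p = vector_derivative (\<lambda>t. h (fst p, t)) (at (snd p))"

text \<open>Class \<open>C\<^sup>k\<close>; meant for open sets.\<close>

fun C_k_on :: "nat \<Rightarrow> (real \<times> real \<Rightarrow> 'a::real_normed_vector) \<Rightarrow> (real \<times> real) set \<Rightarrow> bool" where
  "C_k_on 0 h S \<longleftrightarrow> continuous_on S h"
| "C_k_on (Suc k) h S \<longleftrightarrow>
     (\<forall>p\<in>S. h differentiable (at p)) \<and> C_k_on k (d_u h) S \<and> C_k_on k (d_v h) S"

type_synonym param_surface = "real \<times> real \<Rightarrow> real ^ 3"

definition unit_normal :: "param_surface \<Rightarrow> param_surface" where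
  "unit_normal z p = sgn (cross3 (d_u z p) (d_v z p))"

definition ff_E :: "param_surface \<Rightarrow> real \<times> real \<Rightarrow> real" where
  "ff_E z p = d_u z p \<bullet> d_u z p"

definition ff_F :: "param_surface \<Rightarrow> real \<times> real \<Rightarrow> real" where
  "ff_F z p = d_u z p \<bullet> d_v z p"

definition ff_G :: "param_surface \<Rightarrow> real \<times> real \<Rightarrow> real" where
  "ff_G z p = d_v z p \<bullet> d_v z p"

definition sf_L :: "param_surface \<Rightarrow> real \<times> real \<Rightarrow> real" where
  "sf_L z p = d_u (d_u z) p \<bullet> unit_normal z p"

definition sf_M :: "param_surface \<Rightarrow> real \<times> real \<Rightarrow> real" where
  "sf_M z p = d_v (d_u z) p \<bullet> unit_normal z p"

definition sf_N :: "param_surface \<Rightarrow> real \<times> real \<Rightarrow> real" where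
  "sf_N z p = d_v (d_v z) p \<bullet> unit_normal z p"

text \<open>
  The principal curvatures and the principal geodesic curvatures below are given by their
  formulas in principal parameters, i.e. they have their geometric meaning only
  when \<open>F = M = 0\<close>.
\<close>

definition nu1 :: "param_surface \<Rightarrow> real \<times> real \<Rightarrow> real" where
  "nu1 z p = sf_L z p / ff_E z p"

definition nu2 :: "param_surface \<Rightarrow> real \<times> real \<Rightarrow> real" where
  "nu2 z p = sf_N z p / ff_G z p"

definition gamma1 :: "param_surface \<Rightarrow> real \<times> real \<Rightarrow> real" where
  "gamma1 z p = - d_v (ff_E z) p / (2 * ff_E z p * sqrt (ff_G z p))"

definition gamma2 :: "param_surface \<Rightarrow> real \<times> real \<Rightarrow> real" where
  "gamma2 z p = d_u (ff_G z) p / (2 * ff_G z p * sqrt (ff_E z p))"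

definition gauss_curv :: "param_surface \<Rightarrow> real \<times> real \<Rightarrow> real" where
  "gauss_curv z p = nu1 z p * nu2 z p"

definition mean_curv :: "param_surface \<Rightarrow> real \<times> real \<Rightarrow> real" where
  "mean_curv z p = (nu1 z p + nu2 z p) / 2"

definition H_prime :: "param_surface \<Rightarrow> real \<times> real \<Rightarrow> real" where
  "H_prime z p = (nu1 z p - nu2 z p) / 2"

text \<open>
  ``Sufficiently smooth'' is read as \<open>C\<^sup>3\<close>: this is what is needed for the principal
  curvatures to be of class \<open>C\<^sup>1\<close> and for the Codazzi equations. The condition
  \<open>\<nu>\<^sub>1 - \<nu>\<^sub>2 > 0\<close> includes the absence of umbilical points.
\<close>

definition principal_surface :: "param_surface \<Rightarrow> (real \<times> real) set \<Rightarrow> bool" where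
  "principal_surface z S \<longleftrightarrow>
     open S \<and> connected S \<and> C_k_on 3 z S \<and>
     (\<forall>p\<in>S. cross3 (d_u z p) (d_v z p) \<noteq> 0) \<and>
     (\<forall>p\<in>S. ff_F z p = 0 \<and> sf_M z p = 0) \<and>
     (\<forall>p\<in>S. nu1 z p - nu2 z p > 0)"

definition geodesic_curvature_condition :: "param_surface \<Rightarrow> (real \<times> real) set \<Rightarrow> bool" where
  "geodesic_curvature_condition z S \<longleftrightarrow>
     (\<forall>p\<in>S. gamma1 z p * gamma2 z p \<noteq> 0) \<or>
     (\<forall>p\<in>S. gamma1 z p = 0 \<and> gamma2 z p \<noteq> 0)"

text \<open>
  The interval \<open>I\<close> need not be open, whence the derivatives within \<open>I\<close>. If \<open>S\<close> is open and
  nonempty, the condition on the gradient of \<open>\<nu>\<close> prevents \<open>I\<close> from being a single point.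
\<close>

definition weingarten_surface :: "param_surface \<Rightarrow> (real \<times> real) set \<Rightarrow> bool" where
  "weingarten_surface z S \<longleftrightarrow>
     (\<exists>(I :: real set) (f :: real \<Rightarrow> real) g f' g' (\<nu> :: real \<times> real \<Rightarrow> real).
        is_interval I \<and>
        (\<forall>t\<in>I. (f has_real_derivative f' t) (at t within I) \<and>
               (g has_real_derivative g' t) (at t within I) \<and>
               f t - g t \<noteq> 0 \<and> f' t * g' t \<noteq> 0) \<and>
        (\<forall>p\<in>S. \<nu> differentiable (at p) \<and> (d_u \<nu> p, d_v \<nu> p) \<noteq> (0, 0) \<and>
               \<nu> p \<in> I \<and> nu1 z p = f (\<nu> p) \<and> nu2 z p = g (\<nu> p)))"

definition linear_fractional_weingarten :: "param_surface \<Rightarrow> (real \<times> real) set \<Rightarrow> bool" where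
  "linear_fractional_weingarten z S \<longleftrightarrow>
     weingarten_surface z S \<and>
     (\<exists>A B C D :: real. B * C - A * D \<noteq> 0 \<and>
        (\<forall>p\<in>S. C * nu2 z p + D \<noteq> 0 \<and>
               nu1 z p = (A * nu2 z p + B) / (C * nu2 z p + D)))"

definition linear_curvature_relation :: "param_surface \<Rightarrow> (real \<times> real) set \<Rightarrow> bool" where
  "linear_curvature_relation z S \<longleftrightarrow>
     (\<exists>\<alpha> \<beta> \<gamma> \<delta> :: real. \<alpha>^2 - \<beta>^2 + 4 * \<gamma> * \<delta> \<noteq> 0 \<and>
        (\<forall>p\<in>S. \<delta> * gauss_curv z p = \<alpha> * mean_curv z p + \<beta> * H_prime z p + \<gamma>))"

end

theory Submission
  imports Defs
begin

text \<open>
  With \<open>a = (\<alpha> + \<beta>)/2\<close> and \<open>b = (\<alpha> - \<beta>)/2\<close> the linear relation reads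
  \<open>\<nu>\<^sub>1 (\<delta> \<nu>\<^sub>2 - a) = b \<nu>\<^sub>2 + \<gamma>\<close>, and \<open>\<alpha>\<^sup>2 - \<beta>\<^sup>2 + 4 \<gamma> \<delta> = 4 (a b + \<gamma> \<delta>)\<close> is four times the
  determinant of the corresponding fractional linear map. So the two relations between the
  curvatures are equivalent by algebra. The analytic content is the Weingarten property, for
  which \<open>\<nu> = \<nu>\<^sub>2\<close> serves as the parameter: its gradient does not vanish since the Codazzi
  equation \<open>(\<nu>\<^sub>2)\<^sub>u = \<gamma>\<^sub>2 \<surd>E (\<nu>\<^sub>1 - \<nu>\<^sub>2)\<close> holds and \<open>\<gamma>\<^sub>2 \<noteq> 0\<close> in both cases of the geodesic curvature
  condition.
\<close>

section \<open>Partial derivatives\<close>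

lemma has_vector_derivative_fst_slice:
  assumes "(h has_derivative D) (at p)"
  shows "((\<lambda>t. h (t, snd p)) has_vector_derivative D (1, 0)) (at (fst p))"
proof -
  have "((\<lambda>t. (t, snd p)) has_derivative (\<lambda>t. (t, 0))) (at (fst p))"
    by (auto intro!: derivative_eq_intros)
  moreover have "(h has_derivative D) (at (fst p, snd p))"
    using assms by simp
  ultimately have "((\<lambda>t. h (t, snd p)) has_derivative (\<lambda>t. D (t, 0))) (at (fst p))"
    using has_derivative_compose[of "\<lambda>t. (t, snd p)" _ "fst p" UNIV h D] by simp
  moreover have "(\<lambda>t. D (t, 0)) = (\<lambda>t. t *\<^sub>R D (1, 0))"
  proof
    show "D (t, 0) = t *\<^sub>R D (1, 0)" for t
      using linear_scale[OF has_derivative_linear[OF assms], of t "(1, 0)"] by simp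
  qed
  ultimately show ?thesis
    by (metis has_vector_derivative_def)
qed

lemma has_vector_derivative_snd_slice:
  assumes "(h has_derivative D) (at p)"
  shows "((\<lambda>t. h (fst p, t)) has_vector_derivative D (0, 1)) (at (snd p))"
proof -
  have "((\<lambda>t. (fst p, t)) has_derivative (\<lambda>t. (0, t))) (at (snd p))"
    by (auto intro!: derivative_eq_intros)
  moreover have "(h has_derivative D) (at (fst p, snd p))"
    using assms by simp
  ultimately have "((\<lambda>t. h (fst p, t)) has_derivative (\<lambda>t. D (0, t))) (at (snd p))"
    using has_derivative_compose[of "\<lambda>t. (fst p, t)" _ "snd p" UNIV h D] by simp
  moreover have "(\<lambda>t. D (0, t)) = (\<lambda>t. t *\<^sub>R D (0, 1))"
  proof
    show "D (0, t) = t *\<^sub>R D (0, 1)" for t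
      using linear_scale[OF has_derivative_linear[OF assms], of t "(0, 1)"] by simp
  qed
  ultimately show ?thesis
    by (metis has_vector_derivative_def)
qed

lemma d_u_eq: "(h has_derivative D) (at p) \<Longrightarrow> d_u h p = D (1, 0)"
  unfolding d_u_def by (intro vector_derivative_at has_vector_derivative_fst_slice)

lemma d_v_eq: "(h has_derivative D) (at p) \<Longrightarrow> d_v h p = D (0, 1)"
  unfolding d_v_def by (intro vector_derivative_at has_vector_derivative_snd_slice)

lemma has_real_derivative_d_u_inner:
  assumes "h differentiable (at (a, b))"
  shows "((\<lambda>t. h (t, b) \<bullet> w) has_real_derivative d_u h (a, b) \<bullet> w) (at a)"
proof -
  obtain D where D: "(h has_derivative D) (at (a, b))"
    using assms unfolding differentiable_def by blast
  have "((\<lambda>t. h (t, b)) has_vector_derivative d_u h (a, b)) (at a)"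
    using has_vector_derivative_fst_slice[OF D] d_u_eq[OF D] by simp
  then have "((\<lambda>t. h (t, b) \<bullet> w) has_vector_derivative d_u h (a, b) \<bullet> w) (at a)"
    by (rule bounded_linear.has_vector_derivative[OF bounded_linear_inner_left])
  then show ?thesis
    by (simp add: has_real_derivative_iff_has_vector_derivative)
qed

lemma has_real_derivative_d_v_inner:
  assumes "h differentiable (at (a, b))"
  shows "((\<lambda>t. h (a, t) \<bullet> w) has_real_derivative d_v h (a, b) \<bullet> w) (at b)"
proof -
  obtain D where D: "(h has_derivative D) (at (a, b))"
    using assms unfolding differentiable_def by blast
  have "((\<lambda>t. h (a, t)) has_vector_derivative d_v h (a, b)) (at b)"
    using has_vector_derivative_snd_slice[OF D] d_v_eq[OF D] by simp
  then have "((\<lambda>t. h (a, t) \<bullet> w) has_vector_derivative d_v h (a, b) \<bullet> w) (at b)"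
    by (rule bounded_linear.has_vector_derivative[OF bounded_linear_inner_left])
  then show ?thesis
    by (simp add: has_real_derivative_iff_has_vector_derivative)
qed

lemma d_u_inner:
  assumes "f differentiable (at p)" "g differentiable (at p)"
  shows "d_u (\<lambda>q. f q \<bullet> g q) p = d_u f p \<bullet> g p + f p \<bullet> d_u g p"
proof -
  obtain Df Dg where D: "(f has_derivative Df) (at p)" "(g has_derivative Dg) (at p)"
    using assms unfolding differentiable_def by blast
  show ?thesis
    by (simp add: d_u_eq[OF D(1)] d_u_eq[OF D(2)] d_u_eq[OF has_derivative_inner[OF D]])
qed

lemma d_v_inner:
  assumes "f differentiable (at p)" "g differentiable (at p)"
  shows "d_v (\<lambda>q. f q \<bullet> g q) p = d_v f p \<bullet> g p + f p \<bullet> d_v g p"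
proof -
  obtain Df Dg where D: "(f has_derivative Df) (at p)" "(g has_derivative Dg) (at p)"
    using assms unfolding differentiable_def by blast
  show ?thesis
    by (simp add: d_v_eq[OF D(1)] d_v_eq[OF D(2)] d_v_eq[OF has_derivative_inner[OF D]])
qed

lemma d_u_cong_open:
  assumes "open S" "p \<in> S" "f differentiable (at p)" "\<And>q. q \<in> S \<Longrightarrow> f q = g q"
  shows "d_u f p = d_u g p"
proof -
  obtain D where "(f has_derivative D) (at p)"
    using assms(3) unfolding differentiable_def by blast
  moreover from this have "(g has_derivative D) (at p)"
    using has_derivative_transform_within_open assms by blast
  ultimately show ?thesis
    by (metis d_u_eq)
qed

lemma d_v_cong_open:
  assumes "open S" "p \<in> S" "f differentiable (at p)" "\<And>q. q \<in> S \<Longrightarrow> f q = g q"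
  shows "d_v f p = d_v g p"
proof -
  obtain D where "(f has_derivative D) (at p)"
    using assms(3) unfolding differentiable_def by blast
  moreover from this have "(g has_derivative D) (at p)"
    using has_derivative_transform_within_open assms by blast
  ultimately show ?thesis
    by (metis d_v_eq)
qed

lemma d_u_inner_const:
  assumes "open S" "p \<in> S" "f differentiable (at p)" "g differentiable (at p)"
    and "\<And>q. q \<in> S \<Longrightarrow> f q \<bullet> g q = c"
  shows "d_u f p \<bullet> g p + f p \<bullet> d_u g p = 0"
proof -
  have "d_u (\<lambda>q. f q \<bullet> g q) p = d_u (\<lambda>q. c) p"
    by (rule d_u_cong_open) (use assms in auto)
  also have "\<dots> = 0"
    by (simp add: d_u_def)
  finally show ?thesis
    using d_u_inner[OF assms(3,4)] by simp
qed

lemma d_v_inner_const: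
  assumes "open S" "p \<in> S" "f differentiable (at p)" "g differentiable (at p)"
    and "\<And>q. q \<in> S \<Longrightarrow> f q \<bullet> g q = c"
  shows "d_v f p \<bullet> g p + f p \<bullet> d_v g p = 0"
proof -
  have "d_v (\<lambda>q. f q \<bullet> g q) p = d_v (\<lambda>q. c) p"
    by (rule d_v_cong_open) (use assms in auto)
  also have "\<dots> = 0"
    by (simp add: d_v_def)
  finally show ?thesis
    using d_v_inner[OF assms(3,4)] by simp
qed

section \<open>Symmetry of the second derivatives\<close>

lemma second_difference_mvt:
  fixes \<phi> :: "real \<Rightarrow> real \<Rightarrow> real"
  assumes "s > 0"
    and \<phi>1: "\<And>x y. \<lbrakk>x \<in> {a..a + s}; y \<in> {b..b + s}\<rbrakk>
               \<Longrightarrow> ((\<lambda>x. \<phi> x y) has_real_derivative \<phi>1 x y) (at x)"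
    and \<phi>12: "\<And>x y. \<lbrakk>x \<in> {a..a + s}; y \<in> {b..b + s}\<rbrakk>
               \<Longrightarrow> ((\<lambda>y. \<phi>1 x y) has_real_derivative \<phi>12 x y) (at y)"
  shows "\<exists>\<xi>\<in>{a..a + s}. \<exists>\<eta>\<in>{b..b + s}.
           \<phi> (a + s) (b + s) - \<phi> (a + s) b - \<phi> a (b + s) + \<phi> a b = s * s * \<phi>12 \<xi> \<eta>"
proof -
  define \<psi> where "\<psi> = (\<lambda>x. \<phi> x (b + s) - \<phi> x b)"
  have "(\<psi> has_real_derivative \<phi>1 x (b + s) - \<phi>1 x b) (at x)" if "a \<le> x" "x \<le> a + s" for x
    unfolding \<psi>_def using that \<open>s > 0\<close> by (intro DERIV_diff \<phi>1) auto
  then obtain \<xi> where \<xi>: "a < \<xi>" "\<xi> < a + s"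
    and 1: "\<psi> (a + s) - \<psi> a = s * (\<phi>1 \<xi> (b + s) - \<phi>1 \<xi> b)"
    using MVT2[of a "a + s" \<psi> "\<lambda>x. \<phi>1 x (b + s) - \<phi>1 x b"] \<open>s > 0\<close> by auto
  obtain \<eta> where \<eta>: "b < \<eta>" "\<eta> < b + s" "\<phi>1 \<xi> (b + s) - \<phi>1 \<xi> b = s * \<phi>12 \<xi> \<eta>"
    using MVT2[of b "b + s" "\<phi>1 \<xi>" "\<phi>12 \<xi>"] \<phi>12[of \<xi>] \<xi> \<open>s > 0\<close> by auto
  have "\<phi> (a + s) (b + s) - \<phi> (a + s) b - \<phi> a (b + s) + \<phi> a b = s * s * \<phi>12 \<xi> \<eta>"
    using 1 \<eta>(3) by (simp add: \<psi>_def)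
  then show ?thesis
    using \<xi> \<eta> by force
qed

lemma C_2_mixed_partials:
  fixes h :: "real \<times> real \<Rightarrow> 'a::real_inner"
  assumes "open S" "p \<in> S" "C_k_on 2 h S"
  shows "d_v (d_u h) p = d_u (d_v h) p"
proof -
  obtain a b where p: "p = (a, b)"
    by (cases p)
  define w where "w = d_v (d_u h) p - d_u (d_v h) p"
  let ?uv = "\<lambda>q. d_v (d_u h) q \<bullet> w" and ?vu = "\<lambda>q. d_u (d_v h) q \<bullet> w"
  have diff: "h differentiable (at q)" "d_u h differentiable (at q)" "d_v h differentiable (at q)"
    if "q \<in> S" for q
    using assms(3) that by (auto simp: numeral_2_eq_2)
  have "continuous_on S ?uv" "continuous_on S ?vu"
    using assms(3) by (auto simp: numeral_2_eq_2 intro!: continuous_intros)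
  then have "isCont ?uv p" "isCont ?vu p"
    using assms(1,2) continuous_on_eq_continuous_at by blast+
  then have lim: "(?uv \<longlongrightarrow> ?uv p) (nhds p)" "(?vu \<longlongrightarrow> ?vu p) (nhds p)"
    using tendsto_at_iff_tendsto_nhds[of ?uv p] tendsto_at_iff_tendsto_nhds[of ?vu p]
    by (simp_all add: isCont_def)
  have "w \<bullet> w \<le> 2 * e" if "e > 0" for e
  proof -
    have "\<forall>\<^sub>F q in nhds p. dist (?uv q) (?uv p) < e \<and> dist (?vu q) (?vu p) < e \<and> q \<in> S"
      using tendstoD[OF lim(1) that] tendstoD[OF lim(2) that] eventually_nhds_in_open[OF assms(1,2)]
      by (intro eventually_conj)
    then obtain d where "d > 0"
      and d: "\<And>q. dist q p < d \<Longrightarrow> dist (?uv q) (?uv p) < e \<and> dist (?vu q) (?vu p) < e \<and> q \<in> S"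
      by (auto simp: eventually_nhds_metric)
    define s where "s = d / 3"
    have "s > 0"
      using \<open>d > 0\<close> by (simp add: s_def)
    have near: "dist (x, y) p < d" if "x \<in> {a..a + s}" "y \<in> {b..b + s}" for x y
    proof -
      have "dist (x, y) p \<le> \<bar>x - a\<bar> + \<bar>y - b\<bar>"
        using sqrt_sum_squares_le_sum_abs[of "x - a" "y - b"]
        by (simp add: p dist_Pair_Pair dist_real_def)
      then show ?thesis
        using that \<open>d > 0\<close> by (auto simp: s_def)
    qed
    then have in_S: "(x, y) \<in> S" if "x \<in> {a..a + s}" "y \<in> {b..b + s}" for x y
      using d that by blast
    let ?\<Delta> = "h (a + s, b + s) \<bullet> w - h (a + s, b) \<bullet> w - h (a, b + s) \<bullet> w + h (a, b) \<bullet> w"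
    obtain x y where xy: "x \<in> {a..a + s}" "y \<in> {b..b + s}" and 1: "?\<Delta> = s * s * ?uv (x, y)"
      using second_difference_mvt[OF \<open>s > 0\<close>, of a b "\<lambda>x y. h (x, y) \<bullet> w"
          "\<lambda>x y. d_u h (x, y) \<bullet> w" "\<lambda>x y. ?uv (x, y)"]
        has_real_derivative_d_u_inner[OF diff(1)[OF in_S]]
        has_real_derivative_d_v_inner[OF diff(2)[OF in_S]] by blast
    obtain y' x' where xy': "x' \<in> {a..a + s}" "y' \<in> {b..b + s}"
      and 2: "h (a + s, b + s) \<bullet> w - h (a, b + s) \<bullet> w - h (a + s, b) \<bullet> w + h (a, b) \<bullet> w
                = s * s * ?vu (x', y')"
      using second_difference_mvt[OF \<open>s > 0\<close>, of b a "\<lambda>y x. h (x, y) \<bullet> w"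
          "\<lambda>y x. d_v h (x, y) \<bullet> w" "\<lambda>y x. ?vu (x, y)"]
        has_real_derivative_d_v_inner[OF diff(1)[OF in_S]]
        has_real_derivative_d_u_inner[OF diff(3)[OF in_S]] by blast
    have "s * s * ?uv (x, y) = s * s * ?vu (x', y')"
      using 1 2 by linarith
    then have "?uv (x, y) = ?vu (x', y')"
      using \<open>s > 0\<close> by simp
    moreover have "dist (?uv (x, y)) (?uv p) < e" "dist (?vu (x', y')) (?vu p) < e"
      using d near xy xy' by blast+
    moreover have "w \<bullet> w = ?uv p - ?vu p"
      by (metis w_def inner_diff_left)
    ultimately show ?thesis
      unfolding dist_real_def by linarith
  qed
  from this[of "(w \<bullet> w) / 4"] have "w \<bullet> w \<le> 0"
    by (cases "w \<bullet> w > 0") auto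
  then have "w = 0"
    using inner_gt_zero_iff[of w] by (meson not_le)
  then show ?thesis
    by (simp add: w_def)
qed

section \<open>The unit normal\<close>

lemma cross3_orthogonal_complement:
  assumes "cross3 a b \<noteq> 0" "x \<bullet> a = 0" "x \<bullet> b = 0" "x \<bullet> cross3 a b = 0"
  shows "x = 0"
proof -
  have "cross3 x (cross3 a b) = 0"
    using assms by (simp add: Lagrange)
  then show ?thesis
    using cross_dot_cancel[of "cross3 a b" x 0] assms
    by (metis cross_skew cross_zero_right inner_commute inner_zero_right neg_equal_0_iff_equal)
qed

lemma inner_unit_normal [simp]:
  "d_u z p \<bullet> unit_normal z p = 0" "d_v z p \<bullet> unit_normal z p = 0"
  by (simp_all add: unit_normal_def sgn_div_norm dot_cross_self)

lemma unit_normal_differentiable: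
  assumes "d_u z differentiable (at p)" "d_v z differentiable (at p)"
    and "cross3 (d_u z p) (d_v z p) \<noteq> 0"
  shows "unit_normal z differentiable (at p)"
proof -
  have bb: "bounded_bilinear cross3"
    using bilinear_cross bilinear_conv_bounded_bilinear by blast
  obtain Du Dv where "(d_u z has_derivative Du) (at p)" "(d_v z has_derivative Dv) (at p)"
    using assms unfolding differentiable_def by blast
  from bounded_bilinear.FDERIV[OF bb this]
  have c: "(\<lambda>q. cross3 (d_u z q) (d_v z q)) differentiable (at p)"
    by (rule differentiableI)
  have "norm differentiable (at (cross3 (d_u z p) (d_v z p)))"
    using GDERIV_norm[OF assms(3)] by (auto simp: gderiv_def differentiable_def)
  then have "(\<lambda>q. norm (cross3 (d_u z q) (d_v z q))) differentiable (at p)"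
    using differentiable_chain_at[OF c] by (simp add: o_def)
  then have "(\<lambda>q. inverse (norm (cross3 (d_u z q) (d_v z q)))) differentiable (at p)"
    using assms(3) by (intro differentiable_inverse) auto
  then have "(\<lambda>q. inverse (norm (cross3 (d_u z q) (d_v z q))) *\<^sub>R cross3 (d_u z q) (d_v z q))
               differentiable (at p)"
    using c by (rule differentiable_scaleR)
  then show ?thesis
    by (simp add: unit_normal_def[abs_def] sgn_div_norm)
qed

section \<open>The Codazzi equation\<close>

lemma principal_surfaceD:
  assumes "principal_surface z S"
  shows "open S" "connected S"
    and "C_k_on 2 z S" "C_k_on 2 (d_v z) S"
    and "p \<in> S \<Longrightarrow> d_u z differentiable (at p)" "p \<in> S \<Longrightarrow> d_v z differentiable (at p)"
    and "p \<in> S \<Longrightarrow> d_v (d_u z) differentiable (at p)" "p \<in> S \<Longrightarrow> d_u (d_v z) differentiable (at p)"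
    and "p \<in> S \<Longrightarrow> d_v (d_v z) differentiable (at p)"
    and "p \<in> S \<Longrightarrow> unit_normal z differentiable (at p)"
    and "p \<in> S \<Longrightarrow> ff_E z p > 0" "p \<in> S \<Longrightarrow> ff_G z p > 0"
proof -
  have C: "C_k_on 3 z S" and cross: "\<And>p. p \<in> S \<Longrightarrow> cross3 (d_u z p) (d_v z p) \<noteq> 0"
    using assms by (auto simp: principal_surface_def)
  show "open S" "connected S"
    using assms by (auto simp: principal_surface_def)
  show diff: "p \<in> S \<Longrightarrow> d_u z differentiable (at p)" "p \<in> S \<Longrightarrow> d_v z differentiable (at p)"
     "p \<in> S \<Longrightarrow> d_v (d_u z) differentiable (at p)" "p \<in> S \<Longrightarrow> d_u (d_v z) differentiable (at p)"
     "p \<in> S \<Longrightarrow> d_v (d_v z) differentiable (at p)" for p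
    using C by (auto simp: numeral_3_eq_3)
  show "C_k_on 2 (d_v z) S"
    using C by (simp add: numeral_3_eq_3 numeral_2_eq_2)
  show "C_k_on 2 z S"
    using C by (auto simp: numeral_3_eq_3 numeral_2_eq_2
        intro!: continuous_at_imp_continuous_on differentiable_imp_continuous_within)
  show "p \<in> S \<Longrightarrow> unit_normal z differentiable (at p)"
    using unit_normal_differentiable diff cross by blast
  show "p \<in> S \<Longrightarrow> ff_E z p > 0" "p \<in> S \<Longrightarrow> ff_G z p > 0"
    using cross[of p] by (auto simp: ff_E_def ff_G_def)
qed

lemma nu2_differentiable:
  assumes "principal_surface z S" "p \<in> S"
  shows "nu2 z differentiable (at p)"
proof -
  note P = principal_surfaceD[OF assms(1)]
  have "(\<lambda>q. (d_v (d_v z) q \<bullet> unit_normal z q) / (d_v z q \<bullet> d_v z q)) differentiable (at p)"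
    using P(6,9,10,12)[OF assms(2)] by (intro differentiable_divide differentiable_inner) (auto simp: ff_G_def)
  then show ?thesis
    by (simp add: nu2_def[abs_def] sf_N_def ff_G_def)
qed

lemma d_u_nu2:
  assumes "principal_surface z S" "p \<in> S"
  shows "2 * ff_G z p * d_u (nu2 z) p = (nu1 z p - nu2 z p) * d_u (ff_G z) p"
proof -
  note P = principal_surfaceD[OF assms(1)]
  note S = P(1) assms(2)
  note D = P(5-10)[OF assms(2)]
  let ?n = "unit_normal z" and ?E = "ff_E z p" and ?G = "ff_G z p"
  have FM: "d_u z q \<bullet> d_v z q = 0" "d_v (d_u z) q \<bullet> ?n q = 0"
    and cross: "cross3 (d_u z q) (d_v z q) \<noteq> 0" if "q \<in> S" for q
    using assms(1) that by (auto simp: principal_surface_def ff_F_def sf_M_def)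
  have E: "?E \<noteq> 0" and G: "?G \<noteq> 0"
    using P(11,12)[OF assms(2)] by auto
  have sym: "d_u (d_v z) q = d_v (d_u z) q" if "q \<in> S" for q
    using C_2_mixed_partials[OF P(1) that P(3)] by simp
  have nn: "?n q \<bullet> ?n q = 1" if "q \<in> S" for q
    using cross[OF that] norm_sgn[of "cross3 (d_u z q) (d_v z q)"]
    by (simp add: unit_normal_def flip: power2_norm_eq_inner)
  have unit: "d_u ?n p \<bullet> ?n p = 0" "d_v ?n p \<bullet> ?n p = 0"
    using d_u_inner_const[OF S D(6) D(6) nn] d_v_inner_const[OF S D(6) D(6) nn]
    by (simp_all add: inner_commute)
  have n_uu: "d_u z p \<bullet> d_u ?n p = - sf_L z p"
    using d_u_inner_const[OF S D(1,6) inner_unit_normal(1)] by (simp add: sf_L_def)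
  have n_uv: "d_v z p \<bullet> d_u ?n p = 0"
    using d_u_inner_const[OF S D(2,6) inner_unit_normal(2)] by (simp add: sym FM assms(2))
  have n_vu: "d_u z p \<bullet> d_v ?n p = 0"
    using d_v_inner_const[OF S D(1,6) inner_unit_normal(1)] by (simp add: FM assms(2))
  have n_vv: "d_v z p \<bullet> d_v ?n p = - sf_N z p"
    using d_v_inner_const[OF S D(2,6) inner_unit_normal(2)] by (simp add: sf_N_def)
  have n_perp: "x = 0" if "x \<bullet> d_u z p = 0" "x \<bullet> d_v z p = 0" "x \<bullet> ?n p = 0" for x
  proof (rule cross3_orthogonal_complement[OF cross[OF assms(2)] that(1,2)])
    show "x \<bullet> cross3 (d_u z p) (d_v z p) = 0"
      using that(3) cross[OF assms(2)] by (simp add: unit_normal_def sgn_div_norm)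
  qed
  have "d_u ?n p + nu1 z p *\<^sub>R d_u z p = 0"
    by (rule n_perp)
       (use n_uu n_uv unit FM[OF assms(2)] E in
        \<open>simp_all add: inner_add_left inner_add_right inner_commute nu1_def ff_E_def\<close>)
  then have n_u: "d_u ?n p = - nu1 z p *\<^sub>R d_u z p"
    by (simp add: eq_neg_iff_add_eq_0)
  have "d_v ?n p + nu2 z p *\<^sub>R d_v z p = 0"
    by (rule n_perp)
       (use n_vu n_vv unit FM[OF assms(2)] G in
        \<open>simp_all add: inner_add_left inner_add_right inner_commute nu2_def ff_G_def\<close>)
  then have n_v: "d_v ?n p = - nu2 z p *\<^sub>R d_v z p"
    by (simp add: eq_neg_iff_add_eq_0)
  \<comment> \<open>Differentiating \<open>M = 0\<close> in \<open>v\<close> eliminates the third derivative of \<open>z\<close> from \<open>N\<^sub>u\<close>.\<close>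
  have third: "d_u (d_v (d_v z)) p = d_v (d_v (d_u z)) p"
    using C_2_mixed_partials[OF S P(4)] d_v_cong_open[OF S D(4) sym] by simp
  have G_u: "d_u (ff_G z) p = 2 * (d_v (d_u z) p \<bullet> d_v z p)"
    using d_u_inner[OF D(2,2)] sym[OF assms(2)] by (simp add: ff_G_def[abs_def] inner_commute)
  have F_v: "d_v (d_u z) p \<bullet> d_v z p + d_u z p \<bullet> d_v (d_v z) p = 0"
    by (rule d_v_inner_const[OF S D(1,2) FM(1)])
  have M_v: "d_v (d_v (d_u z)) p \<bullet> ?n p + d_v (d_u z) p \<bullet> d_v ?n p = 0"
    by (rule d_v_inner_const[OF S D(3,6) FM(2)])
  have N_u: "d_u (sf_N z) p = d_u (d_v (d_v z)) p \<bullet> ?n p + d_v (d_v z) p \<bullet> d_u ?n p"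
    using d_u_inner[OF D(5,6)] by (simp add: sf_N_def[abs_def])
  have N_diff: "sf_N z differentiable (at p)"
    unfolding sf_N_def[abs_def] using D(5,6) by (rule differentiable_inner)
  have G_diff: "ff_G z differentiable (at p)"
    unfolding ff_G_def[abs_def] using D(2,2) by (rule differentiable_inner)
  have "d_u (sf_N z) p = d_u (\<lambda>q. nu2 z q \<bullet> ff_G z q) p"
    by (rule d_u_cong_open[OF S N_diff]) (use P(12) in \<open>force simp: nu2_def\<close>)
  also have "\<dots> = d_u (nu2 z) p * ?G + nu2 z p * d_u (ff_G z) p"
    using d_u_inner[OF nu2_differentiable[OF assms] G_diff] by simp
  finally have "d_u (nu2 z) p * ?G + nu2 z p * d_u (ff_G z) p
      = nu2 z p * (d_v (d_u z) p \<bullet> d_v z p) + nu1 z p * (d_v (d_u z) p \<bullet> d_v z p)"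
    using N_u M_v F_v third by (simp add: n_u n_v inner_commute add_eq_0_iff2)
  then show ?thesis
    by (simp add: G_u algebra_simps)
qed

lemma gamma2_codazzi:
  assumes "principal_surface z S" "p \<in> S"
  shows "d_u (nu2 z) p = gamma2 z p * sqrt (ff_E z p) * (nu1 z p - nu2 z p)"
proof -
  have pos: "ff_E z p > 0" "ff_G z p > 0"
    using principal_surfaceD(11,12)[OF assms] .
  have "d_u (nu2 z) p = d_u (ff_G z) p / (2 * ff_G z p) * (nu1 z p - nu2 z p)"
    using d_u_nu2[OF assms] pos by (simp add: eq_divide_eq mult.commute)
  also have "d_u (ff_G z) p / (2 * ff_G z p) = gamma2 z p * sqrt (ff_E z p)"
    using pos by (simp add: gamma2_def)
  finally show ?thesis .
qed

section \<open>Linear and linear fractional relations\<close>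

lemma fractional_linear_has_derivative:
  fixes A B C D t :: real
  assumes "C * t + D \<noteq> 0"
  shows "((\<lambda>t. (A * t + B) / (C * t + D)) has_real_derivative
           (A * D - B * C) / (C * t + D)\<^sup>2) (at t within I)"
proof -
  have "((\<lambda>t. A * t + B) has_real_derivative A) (at t within I)"
    "((\<lambda>t. C * t + D) has_real_derivative C) (at t within I)"
    by (auto intro!: derivative_eq_intros)
  from DERIV_divide[OF this assms]
  have "((\<lambda>t. (A * t + B) / (C * t + D)) has_real_derivative
           (A * (C * t + D) - (A * t + B) * C) / ((C * t + D) * (C * t + D))) (at t within I)" .
  moreover have "A * (C * t + D) - (A * t + B) * C = A * D - B * C"
    by (simp add: algebra_simps)
  ultimately show ?thesis
    by (simp add: power2_eq_square)
qed

lemma fractional_linear_imp_weingarten: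
  fixes A B C D :: real
  assumes "principal_surface z S" "geodesic_curvature_condition z S"
    and det: "B * C - A * D \<noteq> 0"
    and rel: "\<And>p. p \<in> S \<Longrightarrow> C * nu2 z p + D \<noteq> 0"
      "\<And>p. p \<in> S \<Longrightarrow> nu1 z p = (A * nu2 z p + B) / (C * nu2 z p + D)"
  shows "weingarten_surface z S"
proof -
  have pos: "nu1 z p - nu2 z p > 0" if "p \<in> S" for p
    using assms(1) that by (simp add: principal_surface_def)
  have "continuous_on S (nu2 z)"
    using nu2_differentiable[OF assms(1)]
    by (simp add: continuous_at_imp_continuous_on differentiable_imp_continuous_within)
  then have I: "is_interval (nu2 z ` S)"
    using principal_surfaceD(2)[OF assms(1)] connected_continuous_image is_interval_connected_1
    by blast
  have "d_u (nu2 z) p \<noteq> 0" if "p \<in> S" for p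
    using assms(2) that pos[OF that] principal_surfaceD(11)[OF assms(1) that]
    by (auto simp: geodesic_curvature_condition_def gamma2_codazzi[OF assms(1) that])
  then have surf: "\<forall>p\<in>S. nu2 z differentiable (at p) \<and> (d_u (nu2 z) p, d_v (nu2 z) p) \<noteq> (0, 0) \<and>
      nu2 z p \<in> nu2 z ` S \<and> nu1 z p = (A * nu2 z p + B) / (C * nu2 z p + D) \<and> nu2 z p = nu2 z p"
    using rel(2) nu2_differentiable[OF assms(1)] by blast
  have curve: "\<forall>t\<in>nu2 z ` S.
      ((\<lambda>t. (A * t + B) / (C * t + D)) has_real_derivative (A * D - B * C) / (C * t + D)\<^sup>2)
        (at t within nu2 z ` S) \<and>
      ((\<lambda>t. t) has_real_derivative 1) (at t within nu2 z ` S) \<and>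
      (A * t + B) / (C * t + D) - t \<noteq> 0 \<and> (A * D - B * C) / (C * t + D)\<^sup>2 * 1 \<noteq> 0"
  proof (clarify, intro conjI)
    fix p assume p: "p \<in> S"
    show "((\<lambda>t. (A * t + B) / (C * t + D)) has_real_derivative
            (A * D - B * C) / (C * nu2 z p + D)\<^sup>2) (at (nu2 z p) within nu2 z ` S)"
      using rel(1)[OF p] by (rule fractional_linear_has_derivative)
    show "((\<lambda>t. t) has_real_derivative 1) (at (nu2 z p) within nu2 z ` S)"
      by (rule DERIV_ident)
    show "(A * nu2 z p + B) / (C * nu2 z p + D) - nu2 z p \<noteq> 0"
      using pos[OF p] rel(2)[OF p] by simp
    show "(A * D - B * C) / (C * nu2 z p + D)\<^sup>2 * 1 \<noteq> 0"
      using det rel(1)[OF p] by simp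
  qed
  show ?thesis
    unfolding weingarten_surface_def
    by (rule exI[of _ "nu2 z ` S"], rule exI[of _ "\<lambda>t. (A * t + B) / (C * t + D)"],
        rule exI[of _ "\<lambda>t. t"], rule exI[of _ "\<lambda>t. (A * D - B * C) / (C * t + D)\<^sup>2"],
        rule exI[of _ "\<lambda>t. 1"], rule exI[of _ "nu2 z"], intro conjI I curve surf)
qed

theorem lemma4p1:
  fixes z :: "real \<times> real \<Rightarrow> real ^ 3" and S :: "(real \<times> real) set"
  assumes "principal_surface z S"
    and "geodesic_curvature_condition z S"
  shows "(linear_curvature_relation z S \<longrightarrow> linear_fractional_weingarten z S) \<and>
         (linear_fractional_weingarten z S \<longrightarrow> linear_curvature_relation z S)"
proof (intro conjI impI)
  assume "linear_curvature_relation z S"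
  then obtain \<alpha> \<beta> \<gamma> \<delta> :: real where cond: "\<alpha>\<^sup>2 - \<beta>\<^sup>2 + 4 * \<gamma> * \<delta> \<noteq> 0"
    and lin: "\<And>p. p \<in> S \<Longrightarrow> \<delta> * gauss_curv z p = \<alpha> * mean_curv z p + \<beta> * H_prime z p + \<gamma>"
    by (auto simp: linear_curvature_relation_def)
  define A where "A = (\<alpha> - \<beta>) / 2"
  define D where "D = - (\<alpha> + \<beta>) / 2"
  have "4 * (\<gamma> * \<delta> - A * D) = \<alpha>\<^sup>2 - \<beta>\<^sup>2 + 4 * \<gamma> * \<delta>"
    by (simp add: A_def D_def field_simps power2_eq_square)
  then have det: "\<gamma> * \<delta> - A * D \<noteq> 0"
    using cond by auto
  have eq: "nu1 z p * (\<delta> * nu2 z p + D) = A * nu2 z p + \<gamma>" if "p \<in> S" for p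
    using lin[OF that]
    by (simp add: A_def D_def gauss_curv_def mean_curv_def H_prime_def field_simps)
  have den: "\<delta> * nu2 z p + D \<noteq> 0" if "p \<in> S" for p
  proof
    assume 0: "\<delta> * nu2 z p + D = 0"
    then have "A * nu2 z p + \<gamma> = 0"
      using eq[OF that] by simp
    then have "\<gamma> * \<delta> - A * D = 0"
      using 0 by algebra
    with det show False ..
  qed
  then have "nu1 z p = (A * nu2 z p + \<gamma>) / (\<delta> * nu2 z p + D)" if "p \<in> S" for p
    using eq[OF that] that by (simp add: eq_divide_eq)
  with den det fractional_linear_imp_weingarten[OF assms det]
  show "linear_fractional_weingarten z S"
    unfolding linear_fractional_weingarten_def by blast
next
  assume "linear_fractional_weingarten z S"
  then obtain A B C D :: real where det: "B * C - A * D \<noteq> 0"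
    and rel: "\<And>p. p \<in> S \<Longrightarrow> C * nu2 z p + D \<noteq> 0"
      "\<And>p. p \<in> S \<Longrightarrow> nu1 z p = (A * nu2 z p + B) / (C * nu2 z p + D)"
    by (auto simp: linear_fractional_weingarten_def)
  have "(A - D)\<^sup>2 - (- D - A)\<^sup>2 + 4 * B * C = 4 * (B * C - A * D)"
    by (simp add: power2_eq_square algebra_simps)
  then have "(A - D)\<^sup>2 - (- D - A)\<^sup>2 + 4 * B * C \<noteq> 0"
    using det by simp
  moreover have "C * gauss_curv z p = (A - D) * mean_curv z p + (- D - A) * H_prime z p + B"
    if "p \<in> S" for p
  proof -
    have "nu1 z p * (C * nu2 z p + D) = A * nu2 z p + B"
      using rel[OF that] by simp
    then show ?thesis
      by (simp add: gauss_curv_def mean_curv_def H_prime_def field_simps)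
  qed
  ultimately show "linear_curvature_relation z S"
    unfolding linear_curvature_relation_def by blast
qed

end
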